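(* Let $G$ be a finite group, let $V,W$ be finite sets, and let $B\in\mathbb{Z}_+[G]^{V\times V}$ and $C\in\mathbb{Z}_+[G]^{W\times W}$ be inert matrices. If the augmentations $\mathcal{A}(B)$ and $\mathcal{A}(C)$ are shift equivalent over $\mathbb{Z}_+$, then $B$ and $C$ are shift equivalent over $\mathbb{Z}_+[G]$.
   Context: $\mathbb{N}=\{1,2,\dots\}$ and $\mathbb{Z}_+=\{0,1,2,\dots\}$. $\mathbb{Z}[G]$ is the integral group ring of $G$ and $\mathbb{Z}_+[G]\subset\mathbb{Z}[G]$ is the set of elements with non-negative coefficients. For $h\in G$, $\pi_h:\mathbb{Z}[G]\to\mathbb{Z}$, $\pi_h(\sum_{g} a_g g)=a_h$, applied entrywise to matrices. Matrices may have rows and columns indexed by arbitrary finite sets. For $B\in\mathbb{Z}_+[G]^{V\times V}$, the augmentation is $\mathcal{A}(B)=\sum_{g\in G}\pi_g(B)\in\mathbb{Z}_+^{V\times V}$ and the extension is the matrix $\mathcal{E}(B)\in\mathbb{Z}_+^{(V\times G)\times(V\times G)}$ with $\mathcal{E}(B)_{(i,g),(j,h)}=\pi_{g^{-1}h}(B)_{i,j}$. For a square matrix $A$ over $\mathbb{Z}_+$ indexed by $U$, $X_A$ denotes the edge shift of the directed (multi)graph with vertex set $U$ and $A_{i,j}$ edges from $i$ to $j$, i.e. the set of bi-infinite sequences of edges $(e_k)_{k\in\mathbb{Z}}$ such that the initial vertex of $e_{k+1}$ is the terminal vertex of $e_k$, with the left shift $\sigma$. Its dimension group is $D_A=(\mathbb{Z}^U\times\mathbb{Z})/\!\sim$,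 the direct limit of $\mathbb{Z}^U\xrightarrow{A}\mathbb{Z}^U\xrightarrow{A}\cdots$ (row vectors), where $\sim$ is the equivalence relation generated by $(x,n)\sim(xA,n+1)$. $G$ acts on the graph defined by $\mathcal{E}(B)$: $r\in G$ sends the vertex $(i,g)$ to $(i,rg)$ and sends the $k$-th edge from $(i,g)$ to $(j,h)$ to the $k$-th edge from $(i,rg)$ to $(j,rh)$. The induced free action on $X_{\mathcal{E}(B)}$ is denoted $\beta_B$. The induced action on the dimension group $D_{\mathcal{E}(B)}$ is $r\cdot[(w,n)]=[(rw,n)]$, where $(rw)_{(i,g)}=w_{(i,r^{-1}g)}$. The matrix $B$ is called inert if the free $G$-SFT $(X_{\mathcal{E}(B)},\sigma,\beta_B)$ is inert, i.e. if this action of $G$ on $D_{\mathcal{E}(B)}$ is trivial. Let $\mathcal{R}$ be a subset of a ring. Matrices $A\in\mathcal{R}^{V\times V}$ and $B\in\mathcal{R}^{W\times W}$ are shift equivalent over $\mathcal{R}$ if there are $\ell\in\mathbb{N}$, $R\in\mathcal{R}^{V\times W}$ and $S\in\mathcal{R}^{W\times V}$ with $A^\ell=RS$, $B^\ell=SR$, $AR=RB$ and $SA=BS$. *)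

theory Defs
  imports Complex_Main "HOL-Library.FuncSet" "HOL-Library.Poly_Mapping"
begin

text \<open>
  The finite group is a type of class \<open>{group_add, finite}\<close>.  This class does not assume
  commutativity; it merely writes the product \<open>g h\<close> as \<open>g + h\<close> and the inverse
  \<open>g\<close> to the power \<open>-1\<close> as \<open>- g\<close>.  With this reading, the type \<open>'g \<Rightarrow>\<^sub>0 int\<close>
  of \<^theory>\<open>HOL-Library.Poly_Mapping\<close>, whose multiplication is convolution, is the integral
  group ring, and \<open>Poly_Mapping.lookup a h\<close> is the coefficient of \<open>h\<close> in \<open>a\<close>.
\<close>

type_synonym 'g group_ring = "'g \<Rightarrow>\<^sub>0 int"

lemma lookup_group_ring_times:
  fixes a b :: "'g::{group_add,finite} group_ring"
  shows "Poly_Mapping.lookup (a * b) g = (\<Sum>h\<in>UNIV. Poly_Mapping.lookup a h * Poly_Mapping.lookup b (- h + g))"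
proof -
  have "(\<Sum>q\<in>UNIV. Poly_Mapping.lookup b q when g = h + q) = Poly_Mapping.lookup b (- h + g)" for h
  proof -
    have "g = h + q \<longleftrightarrow> - h + g = q" for q
      by (metis add.assoc add.left_neutral left_minus right_minus)
    then have "(\<Sum>q\<in>UNIV. Poly_Mapping.lookup b q when g = h + q) =
        (\<Sum>q\<in>UNIV. if - h + g = q then Poly_Mapping.lookup b q else 0)"
      by (simp only: when_def)
    then show ?thesis
      by simp
  qed
  then show ?thesis
    by (simp add: lookup_mult Sum_any.expand_superset[of UNIV])
qed

definition group_ring_nonneg :: "'g group_ring set" where
  "group_ring_nonneg = {a. \<forall>g. 0 \<le> Poly_Mapping.lookup a g}"


section \<open>Matrices indexed by finite sets\<close>

text \<open>
  A matrix with rows indexed by \<open>U\<close>, columns indexed by \<open>V\<close> and entries in \<open>R\<close> is an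
  extensional function on \<open>U \<times> V\<close>, so that equality of matrices is equality in HOL.  The index
  sets may be empty.
\<close>

definition matrices :: "'u set \<Rightarrow> 'v set \<Rightarrow> 'a set \<Rightarrow> ('u \<times> 'v \<Rightarrow> 'a) set" where
  "matrices U V R = U \<times> V \<rightarrow>\<^sub>E R"

definition mat_times ::
  "'u set \<Rightarrow> 'v set \<Rightarrow> 'w set \<Rightarrow> ('u \<times> 'v \<Rightarrow> 'a::ring_1) \<Rightarrow> ('v \<times> 'w \<Rightarrow> 'a) \<Rightarrow> 'u \<times> 'w \<Rightarrow> 'a" where
  "mat_times U V W A B = (\<lambda>(i, k) \<in> U \<times> W. \<Sum>j\<in>V. A (i, j) * B (j, k))"

primrec mat_power :: "'v set \<Rightarrow> ('v \<times> 'v \<Rightarrow> 'a::ring_1) \<Rightarrow> nat \<Rightarrow> 'v \<times> 'v \<Rightarrow> 'a" where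
  "mat_power V A 0 = (\<lambda>(i, j) \<in> V \<times> V. if i = j then 1 else 0)"
| "mat_power V A (Suc n) = mat_times V V V A (mat_power V A n)"

definition shift_equivalent ::
  "'a::ring_1 set \<Rightarrow> 'v set \<Rightarrow> ('v \<times> 'v \<Rightarrow> 'a) \<Rightarrow> 'w set \<Rightarrow> ('w \<times> 'w \<Rightarrow> 'a) \<Rightarrow> bool" where
  "shift_equivalent \<R> V A W B \<longleftrightarrow>
     (\<exists>l\<ge>1. \<exists>R \<in> matrices V W \<R>. \<exists>S \<in> matrices W V \<R>.
        mat_power V A l = mat_times V W V R S \<and>
        mat_power W B l = mat_times W V W S R \<and>
        mat_times V V W A R = mat_times V W W R B \<and>
        mat_times W V V S A = mat_times W W V B S)"


section \<open>Augmentation and extension\<close>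

definition coeff_mat :: "'v set \<Rightarrow> 'g \<Rightarrow> ('v \<times> 'v \<Rightarrow> 'g group_ring) \<Rightarrow> 'v \<times> 'v \<Rightarrow> int" where
  "coeff_mat V h B = (\<lambda>(i, j) \<in> V \<times> V. Poly_Mapping.lookup (B (i, j)) h)"

definition augmentation ::
  "'v set \<Rightarrow> ('v \<times> 'v \<Rightarrow> 'g::{group_add,finite} group_ring) \<Rightarrow> 'v \<times> 'v \<Rightarrow> int" where
  "augmentation V B = (\<lambda>(i, j) \<in> V \<times> V. \<Sum>g\<in>UNIV. coeff_mat V g B (i, j))"

definition extension ::
  "'v set \<Rightarrow> ('v \<times> 'v \<Rightarrow> 'g::{group_add,finite} group_ring) \<Rightarrow> ('v \<times> 'g) \<times> ('v \<times> 'g) \<Rightarrow> int" where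
  "extension V B =
     (\<lambda>((i, g), (j, h)) \<in> (V \<times> UNIV) \<times> (V \<times> UNIV). coeff_mat V (- g + h) B (i, j))"


section \<open>Dimension groups and inert matrices\<close>

definition row_vectors :: "'u set \<Rightarrow> ('u \<Rightarrow> int) set" where
  "row_vectors U = U \<rightarrow>\<^sub>E UNIV"

definition row_times :: "'u set \<Rightarrow> ('u \<Rightarrow> int) \<Rightarrow> ('u \<times> 'u \<Rightarrow> int) \<Rightarrow> 'u \<Rightarrow> int" where
  "row_times U x A = (\<lambda>j\<in>U. \<Sum>i\<in>U. x i * A (i, j))"

definition dim_step ::
  "'u set \<Rightarrow> ('u \<times> 'u \<Rightarrow> int) \<Rightarrow> ('u \<Rightarrow> int) \<times> int \<Rightarrow> ('u \<Rightarrow> int) \<times> int \<Rightarrow> bool" where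
  "dim_step U A p q \<longleftrightarrow>
     (\<exists>x n. x \<in> row_vectors U \<and> p = (x, n) \<and> q = (row_times U x A, n + 1))"

definition dim_rel ::
  "'u set \<Rightarrow> ('u \<times> 'u \<Rightarrow> int) \<Rightarrow> ((('u \<Rightarrow> int) \<times> int) \<times> (('u \<Rightarrow> int) \<times> int)) set" where
  "dim_rel U A = {(p, q) \<in> (row_vectors U \<times> UNIV) \<times> (row_vectors U \<times> UNIV).
     equivclp (dim_step U A) p q}"

text \<open>Only the underlying set of the dimension group is needed below.\<close>

definition dim_group :: "'u set \<Rightarrow> ('u \<times> 'u \<Rightarrow> int) \<Rightarrow> (('u \<Rightarrow> int) \<times> int) set set" where
  "dim_group U A = (row_vectors U \<times> UNIV) // dim_rel U A"

definition translate :: "'v set \<Rightarrow> 'g::group_add \<Rightarrow> ('v \<times> 'g \<Rightarrow> int) \<Rightarrow> 'v \<times> 'g \<Rightarrow> int" where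
  "translate V r w = (\<lambda>(i, g) \<in> V \<times> UNIV. w (i, - r + g))"

text \<open>
  The action of \<open>r\<close> on the dimension group of the extension of \<open>B\<close>.  The union over the
  representatives \<open>(w, n)\<close> of a class \<open>c\<close> is a union of equal sets, see \<open>dim_action_class\<close>.
\<close>

definition dim_action ::
  "'v set \<Rightarrow> ('v \<times> 'v \<Rightarrow> 'g::{group_add,finite} group_ring) \<Rightarrow> 'g \<Rightarrow>
     (('v \<times> 'g \<Rightarrow> int) \<times> int) set \<Rightarrow> (('v \<times> 'g \<Rightarrow> int) \<times> int) set" where
  "dim_action V B r c =
     (\<Union>(w, n)\<in>c. dim_rel (V \<times> UNIV) (extension V B) `` {(translate V r w, n)})"

definition inert :: "'v set \<Rightarrow> ('v \<times> 'v \<Rightarrow> 'g::{group_add,finite} group_ring) \<Rightarrow> bool" where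
  "inert V B \<longleftrightarrow>
     (\<forall>r. \<forall>c \<in> dim_group (V \<times> UNIV) (extension V B). dim_action V B r c = c)"

lemma equiv_dim_rel: "equiv (row_vectors U \<times> UNIV) (dim_rel U A)"
proof (rule equivI)
  show "dim_rel U A \<subseteq> (row_vectors U \<times> UNIV) \<times> (row_vectors U \<times> UNIV)"
    by (auto simp: dim_rel_def)
  show "refl_on (row_vectors U \<times> UNIV) (dim_rel U A)"
    by (auto simp: refl_on_def dim_rel_def)
  show "sym (dim_rel U A)"
    by (auto simp: sym_def dim_rel_def intro: equivclp_sym)
  show "trans (dim_rel U A)"
    by (unfold trans_def dim_rel_def, blast intro: equivclp_trans)
qed

lemma translate_in_row_vectors: "translate V r w \<in> row_vectors (V \<times> UNIV)"
  by (auto simp: translate_def row_vectors_def)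

lemma translate_row_times:
  fixes B :: "'v \<times> 'v \<Rightarrow> 'g::{group_add,finite} group_ring"
  shows "translate V r (row_times (V \<times> UNIV) x (extension V B)) =
    row_times (V \<times> UNIV) (translate V r x) (extension V B)"
proof (rule ext, clarify)
  fix j and h :: 'g
  show "translate V r (row_times (V \<times> UNIV) x (extension V B)) (j, h) =
    row_times (V \<times> UNIV) (translate V r x) (extension V B) (j, h)"
  proof (cases "j \<in> V")
    case True
    have assoc: "- y - r + h = - y + (- r + h)" for y
      by (metis add.assoc diff_conv_add_uminus)
    have "(\<Sum>p\<in>V \<times> UNIV. x p * extension V B (p, j, - r + h)) =
        (\<Sum>p\<in>V \<times> UNIV. translate V r x p * extension V B (p, j, h))"
    proof (rule sum.reindex_bij_witness
        [where i = "\<lambda>(i, g). (i, - r + g)" and j = "\<lambda>(i, g). (i, r + g)"])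
      fix p :: "'v \<times> 'g"
      assume "p \<in> V \<times> UNIV"
      then show "translate V r x (case p of (i, g) \<Rightarrow> (i, r + g)) *
            extension V B (case p of (i, g) \<Rightarrow> (i, r + g), j, h) =
          x p * extension V B (p, j, - r + h)"
        using True
        by (auto simp: translate_def extension_def coeff_mat_def minus_add assoc)
    qed auto
    then show ?thesis
      using True by (simp add: translate_def row_times_def)
  qed (simp add: translate_def row_times_def)
qed

lemma dim_rel_translate:
  assumes "((w, n), (w', n')) \<in> dim_rel (V \<times> UNIV) (extension V B)"
  shows "((translate V r w, n), (translate V r w', n')) \<in> dim_rel (V \<times> UNIV) (extension V B)"
proof -
  let ?step = "dim_step (V \<times> UNIV) (extension V B)"
  let ?t = "\<lambda>(w, n). (translate V r w, n)"
  have step: "?step (?t p) (?t q)" if "?step p q" for p q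
    using that
    by (auto simp: dim_step_def translate_row_times translate_in_row_vectors)
  have "equivclp ?step (?t p) (?t q)" if "equivclp ?step p q" for p q
    using that
  proof (induction rule: equivclp_induct)
    case (step y z)
    then show ?case
      using \<open>\<And>p q. ?step p q \<Longrightarrow> ?step (?t p) (?t q)\<close>
      by (meson equivclp_into_equivclp)
  qed simp
  from this[of "(w, n)" "(w', n')"] show ?thesis
    using assms by (auto simp: dim_rel_def translate_in_row_vectors)
qed

lemma dim_action_class:
  assumes "w \<in> row_vectors (V \<times> UNIV)"
  shows "dim_action V B r (dim_rel (V \<times> UNIV) (extension V B) `` {(w, n)}) =
    dim_rel (V \<times> UNIV) (extension V B) `` {(translate V r w, n)}"
proof -
  let ?rel = "dim_rel (V \<times> UNIV) (extension V B)"
  have "?rel `` {(translate V r w', n')} = ?rel `` {(translate V r w, n)}"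
    if "((w, n), (w', n')) \<in> ?rel" for w' n'
    using equiv_class_eq[OF equiv_dim_rel dim_rel_translate[OF that, of r]] by simp
  moreover have "((w, n), (w, n)) \<in> ?rel"
    using assms by (simp add: dim_rel_def)
  ultimately show ?thesis
    unfolding dim_action_def by blast
qed

end

(*
  Let N be the order of G and u the sum of all elements of G.  Inertness of B means that for
  large n the coefficients of each entry of B^n do not depend on the group element.  Hence, with
  A the augmentation of B, the matrix A^n is divisible by N and B^n = (A^n / N) u.  Since x u = u x
  is the augmentation of x times u, the assignment M -> (M / N) u is multiplicative on integer
  matrices divisible by N, with X (M / N) u = (A(X) M / N) u for every matrix X over Z[G], and
  likewise on the other side.  So if (R, S) is a shift equivalence of the augmentations A of B
  and A' of C, then (A^n R / N) u and (A'^m S / N) u form a shift equivalence of B and C.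
*)

theory Submission
  imports Defs "HOL-Library.Cardinality"
begin

section \<open>Algebra of matrices indexed by finite sets\<close>

lemma mat_times_apply:
  "i \<in> U \<Longrightarrow> k \<in> W \<Longrightarrow> mat_times U V W A B (i, k) = (\<Sum>j\<in>V. A (i, j) * B (j, k))"
  by (simp add: mat_times_def)

lemma mat_times_assoc:
  "mat_times U W Z (mat_times U V W A B) C = mat_times U V Z A (mat_times V W Z B C)"
proof (rule ext, clarify)
  fix i k
  show "mat_times U W Z (mat_times U V W A B) C (i, k) =
      mat_times U V Z A (mat_times V W Z B C) (i, k)"
  proof (cases "i \<in> U \<and> k \<in> Z")
    case True
    have "(\<Sum>j\<in>W. (\<Sum>l\<in>V. A (i, l) * B (l, j)) * C (j, k)) =
        (\<Sum>l\<in>V. A (i, l) * (\<Sum>j\<in>W. B (l, j) * C (j, k)))"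
      unfolding sum_distrib_left sum_distrib_right mult.assoc
      by (rule sum.swap)
    with True show ?thesis
      by (simp add: mat_times_apply)
  qed (auto simp: mat_times_def)
qed

lemma mat_power_extensional: "mat_power V A n \<in> extensional (V \<times> V)"
  by (cases n) (auto simp: mat_times_def)

text \<open>Multiplying by the identity matrix restricts a function to the index set, and powers are
  already extensional.\<close>

lemma mat_times_one_left_power:
  assumes "finite V"
  shows "mat_times V V V (mat_power V A 0) (mat_power V A n) = mat_power V A n"
proof -
  have "mat_times V V V (mat_power V A 0) (mat_power V A n) =
      restrict (mat_power V A n) (V \<times> V)"
    using assms
    by (auto simp: mat_times_def fun_eq_iff if_distrib[of "\<lambda>x. x * _"] cong: if_cong)
  then show ?thesis
    by (simp only: extensional_restrict[OF mat_power_extensional])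
qed

lemma mat_power_add:
  assumes "finite V"
  shows "mat_power V A (m + n) = mat_times V V V (mat_power V A m) (mat_power V A n)"
proof (induction m)
  case 0
  show ?case
    by (simp only: add_0 mat_times_one_left_power[OF assms])
next
  case (Suc m)
  then show ?case
    by (simp add: mat_times_assoc)
qed

lemma mat_power_intertwine:
  assumes "finite V" "finite W"
    and R: "R \<in> extensional (V \<times> W)"
    and comm: "mat_times V V W A R = mat_times V W W R B"
  shows "mat_times V V W (mat_power V A n) R = mat_times V W W R (mat_power W B n)"
proof (induction n)
  case 0
  then show ?case
    using assms
    by (auto simp: mat_times_def fun_eq_iff if_distrib[of "\<lambda>x. x * _"]
        if_distrib[of "\<lambda>x. _ * x"] cong: if_cong)
next
  case (Suc n)
  then show ?case
    by (metis comm mat_power.simps(2) mat_times_assoc)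
qed

lemma mat_power_Suc_right:
  assumes "finite V" "A \<in> extensional (V \<times> V)"
  shows "mat_power V A (Suc n) = mat_times V V V (mat_power V A n) A"
  \<comment> \<open>The case \<open>R = A\<close>, \<open>B = A\<close> of intertwining:
    \<open>A\<close> commutes with its own powers.\<close>
  using mat_power_intertwine[OF assms(1,1,2) refl, of n] by simp

lemma mat_times_nonneg:
  fixes A :: "'u \<times> 'v \<Rightarrow> int"
  assumes "A \<in> matrices U V {0..}" "B \<in> matrices V W {0..}"
  shows "mat_times U V W A B \<in> matrices U W {0..}"
  using assms unfolding matrices_def mat_times_def
  by (auto simp: PiE_iff intro!: sum_nonneg mult_nonneg_nonneg)

lemma mat_power_nonneg:
  fixes A :: "'v \<times> 'v \<Rightarrow> int"
  assumes "A \<in> matrices V V {0..}"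
  shows "mat_power V A n \<in> matrices V V {0..}"
proof (induction n)
  case 0
  then show ?case
    by (auto simp: matrices_def PiE_iff extensional_def)
next
  case (Suc n)
  then show ?case
    using assms by (simp add: mat_times_nonneg)
qed

section \<open>Augmentation and constant elements of the group ring\<close>

definition aug :: "'g::finite group_ring \<Rightarrow> int" where
  "aug a = (\<Sum>g\<in>UNIV. Poly_Mapping.lookup a g)"

text \<open>This is \<open>k\<close> times the sum of all group elements; its support is finite
  because the group is.\<close>

definition const_elem :: "int \<Rightarrow> 'g::finite group_ring" where
  "const_elem k = Abs_poly_mapping (\<lambda>_. k)"

lemma lookup_const_elem [simp]: "Poly_Mapping.lookup (const_elem k :: 'g::finite group_ring) g = k"
  by (simp add: const_elem_def)

lemma sum_translate:
  fixes g :: "'g::{group_add,finite}"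
  shows "(\<Sum>h\<in>UNIV. f (- h + g)) = (\<Sum>h\<in>UNIV. f h)"
  by (rule sum.reindex_bij_witness[where i = "\<lambda>h. g + - h" and j = "\<lambda>h. - h + g"])
    (auto simp: minus_add add.assoc simp del: add_uminus_conv_diff)

lemma sum_translate_right:
  fixes g :: "'g::{group_add,finite}"
  shows "(\<Sum>h\<in>UNIV. f (g + h)) = (\<Sum>h\<in>UNIV. f h)"
  by (rule sum.reindex_bij_witness[where i = "\<lambda>h. - g + h" and j = "\<lambda>h. g + h"])
    (auto simp flip: add.assoc)

text \<open>In the convolution at \<open>g\<close>, the argument \<open>- h + g\<close> runs once
  through the whole group, so every coefficient of the product is the same.\<close>

lemma const_elem_times:
  "const_elem k * (a :: 'g::{group_add,finite} group_ring) = const_elem (k * aug a)"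
  by (rule poly_mapping_eqI)
    (simp add: lookup_group_ring_times aug_def sum_translate flip: sum_distrib_left)

lemma times_const_elem:
  "(a :: 'g::{group_add,finite} group_ring) * const_elem k = const_elem (aug a * k)"
  by (rule poly_mapping_eqI)
    (simp add: lookup_group_ring_times aug_def flip: sum_distrib_right)

lemma lookup_sum_group_ring:
  "Poly_Mapping.lookup (\<Sum>i\<in>I. f i :: 'g group_ring) g = (\<Sum>i\<in>I. Poly_Mapping.lookup (f i) g)"
  by (induction I rule: infinite_finite_induct) (auto simp: lookup_add)

lemma const_elem_sum: "(\<Sum>i\<in>I. const_elem (f i)) = const_elem (\<Sum>i\<in>I. f i)"
  by (rule poly_mapping_eqI) (simp add: lookup_sum_group_ring)

lemma aug_const_elem: "aug (const_elem k :: 'g::finite group_ring) = int CARD('g) * k"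
  by (simp add: aug_def)

lemma aug_sum: "aug (\<Sum>i\<in>I. f i :: 'g::finite group_ring) = (\<Sum>i\<in>I. aug (f i))"
  unfolding aug_def lookup_sum_group_ring by (rule sum.swap)

text \<open>After exchanging the two sums, the inner one runs over a left translate of the group and
  no longer depends on \<open>h\<close>.\<close>

lemma aug_mult: "aug (a * b :: 'g::{group_add,finite} group_ring) = aug a * aug b"
proof -
  have "aug (a * b) = (\<Sum>h\<in>UNIV. Poly_Mapping.lookup a h *
      (\<Sum>g\<in>UNIV. Poly_Mapping.lookup b (- h + g)))"
    unfolding aug_def lookup_group_ring_times sum_distrib_left by (rule sum.swap)
  then show ?thesis
    by (simp add: sum_translate_right aug_def sum_distrib_right)
qed

lemma aug_one: "aug (1 :: 'g::{group_add,finite} group_ring) = 1"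
  by (simp add: aug_def lookup_one when_def)

section \<open>Augmentation of matrices, and the lift of divisible integer matrices\<close>

definition aug_mat :: "'u set \<Rightarrow> 'v set \<Rightarrow> ('u \<times> 'v \<Rightarrow> 'g::finite group_ring) \<Rightarrow> 'u \<times> 'v \<Rightarrow> int" where
  "aug_mat U V X = (\<lambda>p \<in> U \<times> V. aug (X p))"

lemma augmentation_eq_aug_mat: "augmentation V B = aug_mat V V B"
  by (auto simp: augmentation_def aug_mat_def aug_def coeff_mat_def fun_eq_iff)

lemma aug_mat_times:
  fixes X :: "'u \<times> 'v \<Rightarrow> 'g::{group_add,finite} group_ring"
  shows "aug_mat U W (mat_times U V W X Y) = mat_times U V W (aug_mat U V X) (aug_mat V W Y)"
  by (auto simp: aug_mat_def mat_times_def aug_sum aug_mult fun_eq_iff)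

lemma aug_mat_power:
  fixes B :: "'v \<times> 'v \<Rightarrow> 'g::{group_add,finite} group_ring"
  shows "aug_mat V V (mat_power V B n) = mat_power V (aug_mat V V B) n"
proof (induction n)
  case 0
  have "aug (0 :: 'g group_ring) = 0"
    by (simp add: aug_def)
  then show ?case
    by (auto simp: aug_mat_def aug_one fun_eq_iff)
next
  case (Suc n)
  then show ?case
    by (simp add: aug_mat_times)
qed

lemma aug_mat_nonneg:
  assumes "X \<in> matrices U V group_ring_nonneg"
  shows "aug_mat U V X \<in> matrices U V {0..}"
  using assms
  by (auto simp: aug_mat_def matrices_def aug_def group_ring_nonneg_def PiE_iff intro!: sum_nonneg)

text \<open>
  \<open>spread U V M\<close> is the matrix \<open>(M / N) u\<close> of the header; it is meaningful only when \<open>M\<close> is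
  divisible by the group order.
\<close>

definition spread :: "'u set \<Rightarrow> 'v set \<Rightarrow> ('u \<times> 'v \<Rightarrow> int) \<Rightarrow> 'u \<times> 'v \<Rightarrow> 'g::finite group_ring" where
  "spread U V M = (\<lambda>p \<in> U \<times> V. const_elem (M p div int CARD('g)))"

definition mat_dvd :: "int \<Rightarrow> 'u set \<Rightarrow> 'v set \<Rightarrow> ('u \<times> 'v \<Rightarrow> int) \<Rightarrow> bool" where
  "mat_dvd N U V M \<longleftrightarrow> (\<forall>p \<in> U \<times> V. N dvd M p)"

lemma mat_dvd_times_left:
  "mat_dvd N U V M \<Longrightarrow> mat_dvd N U W (mat_times U V W M X)"
  by (auto simp: mat_dvd_def mat_times_apply intro!: dvd_sum)

text \<open>A constant element has augmentation group order times its coefficient, which undoes the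
  division: \<open>spread\<close> is a right inverse of \<open>aug_mat\<close> on divisible
  matrices.\<close>

lemma aug_mat_spread:
  assumes "mat_dvd (int CARD('g::finite)) U V M" "M \<in> extensional (U \<times> V)"
  shows "aug_mat U V (spread U V M :: _ \<Rightarrow> 'g group_ring) = M"
  using assms
  by (force simp: aug_mat_def spread_def mat_dvd_def aug_const_elem extensional_def fun_eq_iff)

text \<open>Constant elements absorb the entries of \<open>X\<close> through their augmentations.
  Integer division need not commute with sums, so divisibility of \<open>M\<close> is used to pull
  the group order out of the whole sum first.\<close>

lemma spread_times:
  fixes X :: "'v \<times> 'w \<Rightarrow> 'g::{group_add,finite} group_ring"
  assumes "mat_dvd (int CARD('g)) U V M"
  shows "mat_times U V W (spread U V M) X = spread U W (mat_times U V W M (aug_mat V W X))"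
proof (rule ext, clarify)
  fix i k
  show "mat_times U V W (spread U V M) X (i, k) =
      spread U W (mat_times U V W M (aug_mat V W X)) (i, k)"
  proof (cases "i \<in> U \<and> k \<in> W")
    case True
    have "(\<Sum>j\<in>V. M (i, j) * aug_mat V W X (j, k)) =
        (\<Sum>j\<in>V. int CARD('g) * (M (i, j) div int CARD('g) * aug_mat V W X (j, k)))"
      using assms True by (intro sum.cong) (auto simp: mat_dvd_def simp flip: mult.assoc)
    then have "(\<Sum>j\<in>V. M (i, j) * aug_mat V W X (j, k)) div int CARD('g) =
        (\<Sum>j\<in>V. M (i, j) div int CARD('g) * aug_mat V W X (j, k))"
      by (simp flip: sum_distrib_left)
    with True show ?thesis
      by (simp add: mat_times_apply spread_def const_elem_times const_elem_sum aug_mat_def)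
  qed (auto simp: mat_times_def spread_def)
qed

lemma times_spread:
  fixes X :: "'u \<times> 'v \<Rightarrow> 'g::{group_add,finite} group_ring"
  assumes "mat_dvd (int CARD('g)) V W M"
  shows "mat_times U V W X (spread V W M) = spread U W (mat_times U V W (aug_mat U V X) M)"
proof (rule ext, clarify)
  fix i k
  show "mat_times U V W X (spread V W M) (i, k) =
      spread U W (mat_times U V W (aug_mat U V X) M) (i, k)"
  proof (cases "i \<in> U \<and> k \<in> W")
    case True
    have "(\<Sum>j\<in>V. aug_mat U V X (i, j) * M (j, k)) =
        (\<Sum>j\<in>V. int CARD('g) * (aug_mat U V X (i, j) * (M (j, k) div int CARD('g))))"
      using assms True
      by (intro sum.cong) (auto simp: mat_dvd_def mult.left_commute[of "int CARD('g)"])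
    then have "(\<Sum>j\<in>V. aug_mat U V X (i, j) * M (j, k)) div int CARD('g) =
        (\<Sum>j\<in>V. aug_mat U V X (i, j) * (M (j, k) div int CARD('g)))"
      by (simp flip: sum_distrib_left)
    with True show ?thesis
      by (simp add: mat_times_apply spread_def times_const_elem const_elem_sum aug_mat_def)
  qed (auto simp: mat_times_def spread_def)
qed

lemma spread_nonneg:
  assumes "M \<in> matrices U V {0..}"
  shows "(spread U V M :: _ \<Rightarrow> 'g::finite group_ring) \<in> matrices U V group_ring_nonneg"
  using assms
  by (auto simp: spread_def matrices_def group_ring_nonneg_def PiE_iff pos_imp_zdiv_nonneg_iff)

section \<open>Consequences of inertness for powers of the matrix\<close>

text \<open>Each step applies a fixed function, so a zigzag of steps can be pushed forward until its
  two ends meet. The equation on levels records how the two step counts are related.\<close>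

lemma equivclp_dim_step_funpow:
  assumes "equivclp (dim_step U A) p q"
  shows "\<exists>k l. ((\<lambda>x. row_times U x A) ^^ k) (fst p) = ((\<lambda>x. row_times U x A) ^^ l) (fst q) \<and>
    snd p + int k = snd q + int l"
  using assms
proof (induction rule: equivclp_induct)
  case base
  then show ?case
    by blast
next
  case (step y z)
  let ?f = "\<lambda>x. row_times U x A"
  obtain k l where kl: "(?f ^^ k) (fst p) = (?f ^^ l) (fst y)" "snd p + int k = snd y + int l"
    using step.IH by blast
  show ?case
    using step.hyps(2)
  proof
    \<comment> \<open>A forward step: one more application on both sides, absorbed into
      \<open>z\<close> on the right.\<close>
    assume "dim_step U A y z"
    then have "fst z = ?f (fst y)" "snd z = snd y + 1"
      by (auto simp: dim_step_def)
    with kl have "(?f ^^ Suc k) (fst p) = (?f ^^ l) (fst z)"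
      "snd p + int (Suc k) = snd z + int l"
      using funpow_swap1[of ?f l "fst y"] by simp_all
    then show ?thesis
      by blast
  next
    \<comment> \<open>A backward step: \<open>y\<close> is the image of \<open>z\<close>, so only
      the count at \<open>z\<close> grows.\<close>
    assume "dim_step U A z y"
    then have "fst y = ?f (fst z)" "snd y = snd z + 1"
      by (auto simp: dim_step_def)
    with kl have "(?f ^^ k) (fst p) = (?f ^^ Suc l) (fst z)"
      "snd p + int k = snd z + int (Suc l)"
      using funpow_swap1[of ?f l "fst z"] by simp_all
    then show ?thesis
      by blast
  qed
qed

definition unit_row :: "'u set \<Rightarrow> 'u \<Rightarrow> 'u \<Rightarrow> int" where
  "unit_row U p = (\<lambda>q \<in> U. if q = p then 1 else 0)"

lemma translate_unit_row:
  "translate V r (unit_row (V \<times> UNIV) (i, g)) = unit_row (V \<times> UNIV) (i, r + g)"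
proof -
  have "- r + h = g \<longleftrightarrow> h = r + g" for h
    by (metis add.assoc add.left_neutral left_minus right_minus)
  then show ?thesis
    by (auto simp: translate_def unit_row_def fun_eq_iff)
qed

text \<open>Extension is multiplicative: summing over the group coordinate of the middle vertex is
  convolution. Hence iterating on a unit row reads off a row of the extension of
  \<open>mat_power V B k\<close>.\<close>

lemma funpow_row_times_unit_row:
  fixes B :: "'v \<times> 'v \<Rightarrow> 'g::{group_add,finite} group_ring"
  assumes "finite V" "B \<in> extensional (V \<times> V)" "i \<in> V" "j \<in> V"
  shows "((\<lambda>x. row_times (V \<times> UNIV) x (extension V B)) ^^ k) (unit_row (V \<times> UNIV) (i, g)) (j, h) =
    Poly_Mapping.lookup (mat_power V B k (i, j)) (- g + h)"
  using assms(4)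
proof (induction k arbitrary: j h)
  case 0
  have "- g + h = 0 \<longleftrightarrow> h = g"
    by (metis add.assoc add.left_neutral add.right_neutral left_minus right_minus)
  then show ?case
    using 0 assms by (auto simp: unit_row_def lookup_one when_def)
next
  case (Suc k)
  let ?L = "Poly_Mapping.lookup"
  \<comment> \<open>The substitution of \<open>f\<close> for \<open>- g + f\<close> turns the sum
    into the convolution formula.\<close>
  have inner: "(\<Sum>f\<in>UNIV. ?L a (- g + f) * ?L b (- f + h)) = ?L (a * b) (- g + h)"
    for a b :: "'g group_ring"
  proof -
    have "- (- g + f) + (- g + h) = - f + h" for f
      by (simp add: minus_add add.assoc flip: add.assoc[of g "- g"])
    then have "(\<Sum>f\<in>UNIV. ?L a (- g + f) * ?L b (- f + h)) =
        (\<Sum>f\<in>UNIV. (\<lambda>f. ?L a f * ?L b (- f + (- g + h))) (- g + f))"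
      by simp
    also have "\<dots> = ?L (a * b) (- g + h)"
      by (simp only: sum_translate_right[of "\<lambda>f. ?L a f * ?L b (- f + (- g + h))"]
          lookup_group_ring_times)
    finally show ?thesis .
  qed
  let ?f = "\<lambda>x. row_times (V \<times> UNIV) x (extension V B)"
  let ?x = "(?f ^^ k) (unit_row (V \<times> UNIV) (i, g))"
  have "(?f ^^ Suc k) (unit_row (V \<times> UNIV) (i, g)) (j, h) =
      (\<Sum>p\<in>V \<times> UNIV. ?x p * extension V B (p, j, h))"
    using Suc.prems by (simp add: row_times_def)
  also have "\<dots> = (\<Sum>(l, f)\<in>V \<times> UNIV. ?L (mat_power V B k (i, l)) (- g + f) * ?L (B (l, j)) (- f + h))"
  proof (rule sum.cong, rule refl, clarify)
    fix l f
    assume "l \<in> V"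
    moreover from this have "extension V B ((l, f), (j, h)) = ?L (B (l, j)) (- f + h)"
      using assms(3) Suc.prems by (simp add: extension_def coeff_mat_def)
    ultimately show "?x (l, f) * extension V B ((l, f), (j, h)) =
        ?L (mat_power V B k (i, l)) (- g + f) * ?L (B (l, j)) (- f + h)"
      by (simp only: Suc.IH)
  qed
  also have "\<dots> = (\<Sum>l\<in>V. ?L (mat_power V B k (i, l) * B (l, j)) (- g + h))"
    by (simp add: sum.cartesian_product[symmetric] inner)
  also have "\<dots> = ?L (mat_power V B (Suc k) (i, j)) (- g + h)"
    \<comment> \<open>Row iteration adds factors on the right, whereas \<open>mat_power\<close> adds
      them on the left.\<close>
    unfolding mat_power_Suc_right[OF assms(1,2)]
    using assms Suc.prems by (simp add: mat_times_apply lookup_sum_group_ring)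
  finally show ?case .
qed

lemma inert_funpow_translate:
  fixes B :: "'v \<times> 'v \<Rightarrow> 'g::{group_add,finite} group_ring"
  assumes "inert V B" "w \<in> row_vectors (V \<times> UNIV)"
  shows "\<exists>k. ((\<lambda>x. row_times (V \<times> UNIV) x (extension V B)) ^^ k) (translate V r w) =
    ((\<lambda>x. row_times (V \<times> UNIV) x (extension V B)) ^^ k) w"
proof -
  let ?rel = "dim_rel (V \<times> UNIV) (extension V B)"
  have "?rel `` {(w, 0)} \<in> dim_group (V \<times> UNIV) (extension V B)"
    using assms(2) by (auto simp: dim_group_def intro: quotientI)
  then have "?rel `` {(translate V r w, 0)} = ?rel `` {(w, 0)}"
    using assms(1) dim_action_class[OF assms(2), of B r 0] by (simp add: inert_def)
  then have "((translate V r w, 0), (w, 0)) \<in> ?rel"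
    using assms(2) by (intro eq_equiv_class[OF _ equiv_dim_rel]) auto
  then have "equivclp (dim_step (V \<times> UNIV) (extension V B)) (translate V r w, 0) (w, 0)"
    by (simp add: dim_rel_def)
  \<comment> \<open>Both representatives have level 0, so the two step counts coincide.\<close>
  from equivclp_dim_step_funpow[OF this] show ?thesis
    by auto
qed

text \<open>Inertness identifies the rows at \<open>(i, h)\<close> and \<open>(i, 0)\<close> of a
  high power of the extension. Finitely many rows allow one exponent for all, and equality of these
  rows makes each entry of that power of \<open>B\<close> constant on the group.\<close>

lemma inert_power_eq_spread:
  fixes B :: "'v \<times> 'v \<Rightarrow> 'g::{group_add,finite} group_ring"
  assumes "finite V" "B \<in> extensional (V \<times> V)" "inert V B"
  obtains n where "mat_dvd (int CARD('g)) V V (mat_power V (aug_mat V V B) n)"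
    and "mat_power V B n = spread V V (mat_power V (aug_mat V V B) n)"
proof -
  let ?f = "\<lambda>x. row_times (V \<times> UNIV) x (extension V B)"
  let ?e = "\<lambda>i g. unit_row (V \<times> (UNIV :: 'g set)) (i, g)"
  have "\<exists>k. (?f ^^ k) (?e i r) = (?f ^^ k) (?e i 0)" for i r
    using inert_funpow_translate[OF assms(3), of "?e i 0" r] translate_unit_row[of V r i 0]
    by (auto simp: row_vectors_def unit_row_def)
  then obtain k where k: "(?f ^^ k i r) (?e i r) = (?f ^^ k i r) (?e i 0)" for i r
    by metis
  \<comment> \<open>The sum serves only as a common upper bound of all \<open>k i r\<close>; rows
    that agree once agree under further iteration.\<close>
  define n where "n = (\<Sum>(i, r)\<in>V \<times> UNIV. k i r)"
  have const: "Poly_Mapping.lookup (mat_power V B n (i, j)) h =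
      Poly_Mapping.lookup (mat_power V B n (i, j)) 0" if "i \<in> V" "j \<in> V" for i j h
  proof -
    have "k i h \<le> n"
      unfolding n_def using member_le_sum[of "(i, h)" "V \<times> UNIV" "\<lambda>(i, r). k i r"] assms(1) that
      by auto
    then obtain d where d: "n = d + k i h"
      using le_Suc_ex by (metis add.commute)
    have "(?f ^^ n) (?e i h) = (?f ^^ n) (?e i 0)"
      unfolding d funpow_add using k by simp
    \<comment> \<open>In column \<open>(j, h)\<close> the two rows show the coefficients at
      \<open>- h + h = 0\<close> and at \<open>- 0 + h = h\<close>.\<close>
    then show ?thesis
      using funpow_row_times_unit_row[OF assms(1,2) that, of n h h]
        funpow_row_times_unit_row[OF assms(1,2) that, of n 0 h] by simp
  qed
  have aug: "mat_power V (aug_mat V V B) n (i, j) =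
      int CARD('g) * Poly_Mapping.lookup (mat_power V B n (i, j)) 0" if "i \<in> V" "j \<in> V" for i j
  proof -
    have "mat_power V (aug_mat V V B) n (i, j) = aug (mat_power V B n (i, j))"
      using that unfolding aug_mat_power[symmetric] by (simp add: aug_mat_def)
    also have "\<dots> = (\<Sum>h\<in>(UNIV :: 'g set). Poly_Mapping.lookup (mat_power V B n (i, j)) 0)"
      unfolding aug_def by (intro sum.cong refl const that)
    finally show ?thesis
      by simp
  qed
  show thesis
  proof
    show "mat_dvd (int CARD('g)) V V (mat_power V (aug_mat V V B) n)"
      by (auto simp: mat_dvd_def aug)
    show "mat_power V B n = spread V V (mat_power V (aug_mat V V B) n)"
    proof (rule ext, clarify)
      fix i j
      show "mat_power V B n (i, j) = spread V V (mat_power V (aug_mat V V B) n) (i, j)"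
      proof (cases "(i, j) \<in> V \<times> V")
        case True
        then have "spread V V (mat_power V (aug_mat V V B) n) (i, j) =
            (const_elem (Poly_Mapping.lookup (mat_power V B n (i, j)) 0) :: 'g group_ring)"
          by (simp add: spread_def aug)
        moreover have "mat_power V B n (i, j) =
            const_elem (Poly_Mapping.lookup (mat_power V B n (i, j)) 0)"
        proof (rule poly_mapping_eqI)
          fix h
          show "Poly_Mapping.lookup (mat_power V B n (i, j)) h = Poly_Mapping.lookup
              (const_elem (Poly_Mapping.lookup (mat_power V B n (i, j)) 0)) h"
            unfolding lookup_const_elem using True by (intro const) auto
        qed
        ultimately show ?thesis
          by (rule trans[OF _ sym, rotated])
      next
        case False
        then show ?thesis
          using mat_power_extensional[of V B n] by (auto simp: spread_def extensional_def)
      qed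
    qed
  qed
qed

section \<open>Construction of the shift equivalence\<close>

text \<open>Multiplying on the right by \<open>mat_power V B k\<close> preserves the constant form
  by \<open>spread_times\<close>. This covers the exponent of the final shift equivalence, which
  exceeds \<open>n\<close> in general.\<close>

lemma spread_power_add:
  fixes B :: "'v \<times> 'v \<Rightarrow> 'g::{group_add,finite} group_ring"
  assumes "finite V"
    and "mat_dvd (int CARD('g)) V V (mat_power V (aug_mat V V B) n)"
    and "mat_power V B n = spread V V (mat_power V (aug_mat V V B) n)"
  shows "mat_power V B (n + k) = spread V V (mat_power V (aug_mat V V B) (n + k))"
  by (simp add: mat_power_add assms spread_times aug_mat_power)

text \<open>On integer matrices, the power of \<open>A'\<close> moves left across \<open>R\<close>
  and becomes a power of the augmentation of \<open>B\<close>; then \<open>R\<close> and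
  \<open>S\<close> meet and contribute \<open>l\<close> more factors.\<close>

lemma spread_shift_equivalence_product:
  fixes B :: "'v \<times> 'v \<Rightarrow> 'g::{group_add,finite} group_ring"
  assumes fin: "finite V" "finite W"
    and dvdB: "mat_dvd (int CARD('g)) V V (mat_power V (aug_mat V V B) n)"
    and B: "mat_power V B n = spread V V (mat_power V (aug_mat V V B) n)"
    and dvdC: "mat_dvd (int CARD('g)) W W (mat_power W A' m)"
    and R: "R \<in> extensional (V \<times> W)"
    and RS: "mat_power V (aug_mat V V B) l = mat_times V W V R S"
    and comm: "mat_times V V W (aug_mat V V B) R = mat_times V W W R A'"
  shows "mat_times V W V
      (spread V W (mat_times V V W (mat_power V (aug_mat V V B) n) R))
      (spread W V (mat_times W W V (mat_power W A' m) S) :: _ \<Rightarrow> 'g group_ring) =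
    mat_power V B (n + m + l)"
proof -
  let ?A = "aug_mat V V B"
  let ?M = "mat_times W W V (mat_power W A' m) S"
  have "mat_times V W V (mat_times V V W (mat_power V ?A n) R) ?M =
      mat_times V V V (mat_power V ?A n)
        (mat_times V W V (mat_times V W W R (mat_power W A' m)) S)"
    by (simp add: mat_times_assoc)
  also have "\<dots> = mat_times V V V (mat_power V ?A n)
        (mat_times V W V (mat_times V V W (mat_power V ?A m) R) S)"
    by (simp add: mat_power_intertwine[OF fin R comm])
  also have "\<dots> = mat_power V ?A (n + (m + l))"
    by (simp add: mat_times_assoc mat_power_add fin RS[symmetric])
  finally have eq: "mat_times V W V (mat_times V V W (mat_power V ?A n) R) ?M =
      mat_power V ?A (n + (m + l))" .
  \<comment> \<open>The right factor enters \<open>spread_times\<close> through its augmentation,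
    which is \<open>?M\<close> itself. So of the two divisions by the group order only one survives
    in the product.\<close>
  have "aug_mat W V (spread W V ?M :: _ \<Rightarrow> 'g group_ring) = ?M"
    using mat_dvd_times_left[OF dvdC] by (intro aug_mat_spread) (auto simp: mat_times_def)
  then show ?thesis
    using mat_dvd_times_left[OF dvdB, of W R] spread_power_add[OF fin(1) dvdB B, of "m + l"]
    by (simp add: spread_times eq add.assoc)
qed

text \<open>Both sides are lifts of integer matrices, by \<open>times_spread\<close> and
  \<open>spread_times\<close>. These agree because the augmentation of \<open>B\<close> commutes
  with its powers and is intertwined by \<open>R\<close> with that of \<open>C\<close>.\<close>

lemma spread_intertwine:
  fixes B :: "'v \<times> 'v \<Rightarrow> 'g::{group_add,finite} group_ring" and C :: "'w \<times> 'w \<Rightarrow> 'g group_ring"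
  assumes fin: "finite V"
    and dvdB: "mat_dvd (int CARD('g)) V V (mat_power V (aug_mat V V B) n)"
    and comm: "mat_times V V W (aug_mat V V B) R = mat_times V W W R (aug_mat W W C)"
  shows "mat_times V V W B (spread V W (mat_times V V W (mat_power V (aug_mat V V B) n) R)) =
    mat_times V W W (spread V W (mat_times V V W (mat_power V (aug_mat V V B) n) R)) C"
proof -
  let ?A = "aug_mat V V B"
  have "?A \<in> extensional (V \<times> V)"
    by (simp add: aug_mat_def)
  from mat_power_Suc_right[OF fin this, of n]
  have "mat_times V V V ?A (mat_power V ?A n) = mat_times V V V (mat_power V ?A n) ?A"
    by simp
  then have "mat_times V V W ?A (mat_times V V W (mat_power V ?A n) R) =
      mat_times V W W (mat_times V V W (mat_power V ?A n) R) (aug_mat W W C)"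
    by (metis mat_times_assoc comm)
  then show ?thesis
    using mat_dvd_times_left[OF dvdB, of W R] by (simp add: spread_times times_spread)
qed

theorem theorem6p1:
  fixes V :: "'v set" and W :: "'w set"
    and B :: "'v \<times> 'v \<Rightarrow> 'g::{group_add,finite} group_ring"
    and C :: "'w \<times> 'w \<Rightarrow> 'g group_ring"
  assumes "finite V" and "finite W"
    and "B \<in> matrices V V group_ring_nonneg"
    and "C \<in> matrices W W group_ring_nonneg"
    and "inert V B" and "inert W C"
    and "shift_equivalent {0..} V (augmentation V B) W (augmentation W C)"
  shows "shift_equivalent group_ring_nonneg V B W C"
proof -
  note fin = assms(1,2)
  let ?A = "aug_mat V V B" and ?A' = "aug_mat W W C"
  obtain l R S where "l \<ge> 1"
    and R: "R \<in> matrices V W {0..}" and S: "S \<in> matrices W V {0..}"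
    and RS: "mat_power V ?A l = mat_times V W V R S"
    and SR: "mat_power W ?A' l = mat_times W V W S R"
    and AR: "mat_times V V W ?A R = mat_times V W W R ?A'"
    and SA: "mat_times W V V S ?A = mat_times W W V ?A' S"
    using assms(7) unfolding shift_equivalent_def augmentation_eq_aug_mat by blast
  have ext: "B \<in> extensional (V \<times> V)" "C \<in> extensional (W \<times> W)"
    "R \<in> extensional (V \<times> W)" "S \<in> extensional (W \<times> V)"
    using assms(3,4) R S by (auto simp: matrices_def PiE_def)
  obtain n where n: "mat_dvd (int CARD('g)) V V (mat_power V ?A n)"
    "mat_power V B n = spread V V (mat_power V ?A n)"
    using inert_power_eq_spread[OF fin(1) ext(1) assms(5)] .
  obtain m where m: "mat_dvd (int CARD('g)) W W (mat_power W ?A' m)"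
    "mat_power W C m = spread W W (mat_power W ?A' m)"
    using inert_power_eq_spread[OF fin(2) ext(2) assms(6)] .
  define R' where "R' = (spread V W (mat_times V V W (mat_power V ?A n) R) :: _ \<Rightarrow> 'g group_ring)"
  define S' where "S' = (spread W V (mat_times W W V (mat_power W ?A' m) S) :: _ \<Rightarrow> 'g group_ring)"
  have "R' \<in> matrices V W group_ring_nonneg" "S' \<in> matrices W V group_ring_nonneg"
    unfolding R'_def S'_def using assms(3,4) R S
    by (simp_all add: spread_nonneg mat_times_nonneg mat_power_nonneg aug_mat_nonneg)
  moreover have "mat_power V B (n + m + l) = mat_times V W V R' S'"
    unfolding R'_def S'_def
    using spread_shift_equivalence_product[OF fin n m(1) ext(3) RS AR] by simp
  moreover have "mat_power W C (n + m + l) = mat_times W V W S' R'"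
    unfolding R'_def S'_def
    \<comment> \<open>The same product with the roles of \<open>B\<close> and \<open>C\<close>
      exchanged; its exponent comes out as \<open>m + n + l\<close>.\<close>
    using spread_shift_equivalence_product[OF fin(2,1) m n(1) ext(4) SR SA[symmetric]]
    by (simp add: add.commute)
  moreover have "mat_times V V W B R' = mat_times V W W R' C"
    unfolding R'_def by (rule spread_intertwine[OF fin(1) n(1) AR])
  moreover have "mat_times W V V S' B = mat_times W W V C S'"
    unfolding S'_def by (rule spread_intertwine[OF fin(2) m(1) SA[symmetric], symmetric])
  moreover have "n + m + l \<ge> 1"
    using \<open>l \<ge> 1\<close> by simp
  ultimately show ?thesis
    unfolding shift_equivalent_def by blast
qed

end
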